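(* Let $\alpha,\beta>0$ with $\alpha\neq\beta$, let $\mathbb{T}=\mathbb{T}_{\alpha,\beta}=\{k(\alpha+\beta):k\in\mathbb{N}_0\}\cup\{k(\alpha+\beta)+\alpha:k\in\mathbb{N}_0\}$, and for $\lambda\in\mathbb{R}$ consider the equation $$x^\Delta(t)=\lambda x(t),\quad t\in\mathbb{T}. \qquad (\ast)$$ If $\alpha^2+\beta^2-6\alpha\beta\ge 0$, set $$\lambda^+:=\frac{-\alpha-\beta+\sqrt{\alpha^2+\beta^2-6\alpha\beta}}{2\alpha\beta},\qquad \lambda^-:=\frac{-\alpha-\beta-\sqrt{\alpha^2+\beta^2-6\alpha\beta}}{2\alpha\beta}.$$ Let $\varepsilon>0$ be given. Then we have the following cases. A. Let $\alpha\ge(3+2\sqrt{2})\beta$, and let $\frac{-1}{\beta}<\lambda<\lambda^-$ or $\lambda^+<\lambda<\frac{-1}{\alpha}$. Then $(\ast)$ has Hyers--Ulam stability (HUS) with an HUS constant $\dfrac{|\lambda+\frac{1}{\alpha}-\frac{1}{\beta}|}{(\lambda-\lambda^+)(\lambda-\lambda^-)}$. B. Let $\alpha>(3+2\sqrt{2})\beta$, and let $\lambda^-<\lambda<\lambda^+$. Then $(\ast)$ has HUS with an HUS constant $\left|\dfrac{\lambda+\frac{1}{\alpha}-\frac{1}{\beta}}{(\lambda-\lambda^+)(\lambda-\lambda^-)}\right|$. C. Let $\beta<\alpha<(3+2\sqrt{2})\beta$, and let $\frac{-1}{\beta}<\lambda<\frac{-1}{\alpha}$. Then $(\ast)$ has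 HUS with an HUS constant $\left|\dfrac{\lambda+\frac{1}{\alpha}-\frac{1}{\beta}}{\left(\frac{2+\alpha\lambda+\beta\lambda+\alpha\beta\lambda^2}{\alpha\beta}\right)}\right|$. D. Let $0<\alpha\le(3-2\sqrt{2})\beta$, and let $\frac{-1}{\alpha}<\lambda<\lambda^-$ or $\lambda^+<\lambda<\frac{-1}{\beta}$. Then $(\ast)$ has HUS with an HUS constant $\dfrac{\frac{1}{\alpha}-\frac{1}{\beta}-\lambda}{(\lambda-\lambda^+)(\lambda-\lambda^-)}$. E. Let $0<\alpha<(3-2\sqrt{2})\beta$, and let $\lambda^-<\lambda<\lambda^+$. Then $(\ast)$ has HUS with an HUS constant $\dfrac{\frac{1}{\alpha}-\frac{1}{\beta}-\lambda}{|(\lambda-\lambda^+)(\lambda-\lambda^-)|}$. F. Let $(3-2\sqrt{2})\beta<\alpha<\beta$, and let $\frac{-1}{\alpha}<\lambda<\frac{-1}{\beta}$. Then $(\ast)$ has HUS with an HUS constant $\left|\dfrac{\frac{1}{\alpha}-\frac{1}{\beta}-\lambda}{\left(\frac{2+\alpha\lambda+\beta\lambda+\alpha\beta\lambda^2}{\alpha\beta}\right)}\right|$. G. Let $\frac{-1}{\alpha}-\frac{1}{\beta}<\lambda<\min\left\{\frac{-1}{\alpha},\frac{-1}{\beta}\right\}$. Then $(\ast)$ has HUS with an HUS constant $\dfrac{\max\left\{\frac{1}{\beta}-\frac{1}{\alpha}-\lambda,\ \frac{1}{\alpha}-\frac{1}{\beta}-\lambda\right\}}{|\lambda|\left(\lambda+\frac{1}{\alpha}+\frac{1}{\beta}\right)}$.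 H. Let $\lambda<\frac{-1}{\alpha}-\frac{1}{\beta}$. Then $(\ast)$ has HUS with an HUS constant $\dfrac{\max\left\{\frac{1}{\beta}-\frac{1}{\alpha}-\lambda,\ \frac{1}{\alpha}-\frac{1}{\beta}-\lambda\right\}}{|\lambda|\left|\lambda+\frac{1}{\alpha}+\frac{1}{\beta}\right|}$. I. If $\max\left\{\frac{-1}{\alpha},\frac{-1}{\beta}\right\}<\lambda<0$ or $\lambda>0$, then $(\ast)$ has HUS with minimum HUS constant $1/|\lambda|$. J. If $\lambda=0$, $\lambda=\lambda^+$, $\lambda=\lambda^-$, or $\lambda=\frac{-1}{\alpha}-\frac{1}{\beta}$, then $(\ast)$ does not have HUS. K. If $\lambda=\frac{-1}{\alpha}$ or $\lambda=-\frac{1}{\beta}$, then $(\ast)$ does not exist as a first-order dynamic equation.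
   Context: $\mathbb{N}_0=\{0,1,2,\dots\}$. The time scale $\mathbb{T}=\mathbb{T}_{\alpha,\beta}=\{0,\alpha,\alpha+\beta,(\alpha+\beta)+\alpha,2(\alpha+\beta),2(\alpha+\beta)+\alpha,\dots\}$ is discrete and unbounded above. For $t\in\mathbb{T}$, $\sigma(t)$ denotes the next larger point of $\mathbb{T}$ and $\mu(t)=\sigma(t)-t$ is the graininess, so $\mu(t)=\alpha$ if $t=k(\alpha+\beta)$ and $\mu(t)=\beta$ if $t=k(\alpha+\beta)+\alpha$, $k\in\mathbb{N}_0$. For $f:\mathbb{T}\to\mathbb{R}$, the delta derivative is $f^\Delta(t)=\dfrac{f(\sigma(t))-f(t)}{\mu(t)}$. Hyers--Ulam stability: the equation $x^\Delta(t)=\lambda x(t)$ has Hyers--Ulam stability (HUS) on $\mathbb{T}$ iff there exists a constant $K>0$ with the following property: for arbitrary $\varepsilon>0$, if $\phi:\mathbb{T}\to\mathbb{R}$ satisfies $|\phi^\Delta(t)-\lambda\phi(t)|\le\varepsilon$ for all $t\in\mathbb{T}$, then there exists a solution $x:\mathbb{T}\to\mathbb{R}$ of $x^\Delta=\lambda x$ such that $|\phi(t)-x(t)|\le K\varepsilon$ for all $t\in\mathbb{T}$. Any such $K$ is called an HUS constant for the equation on $\mathbb{T}$; the minimum HUS constant is the smallest such $K$. The equation $x^\Delta(t)=\lambda x(t)$ is called regressive iff $1+\lambda\mu(t)\ne0$ for all $t\in\mathbb{T}$. The wording "does not exist as a first-order dynamic equation" in K is not given a separate formal definition; the justification offered for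 it is that for these $\lambda$ one has $1+\lambda\mu(t)=0$ (for some $t$), so that the equation is not regressive. *)

theory Defs
  imports "HOL-Analysis.Analysis"
begin

definition time_scale :: "real \<Rightarrow> real \<Rightarrow> real set" where
  "time_scale \<alpha> \<beta> =
     {real k * (\<alpha> + \<beta>) | k :: nat. True} \<union> {real k * (\<alpha> + \<beta>) + \<alpha> | k :: nat. True}"

text \<open>
  The following notions are meant for a time scale \<open>T\<close> that is discrete and unbounded above, so that
  every point of \<open>T\<close> has a next larger one.  Functions on \<open>T\<close> are represented by total
  functions on the reals, of which only the values on \<open>T\<close> matter.
\<close>

definition fwd_jump :: "real set \<Rightarrow> real \<Rightarrow> real" where
  "fwd_jump T t = (LEAST s. s \<in> T \<and> t < s)"

definition graininess :: "real set \<Rightarrow> real \<Rightarrow> real" where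
  "graininess T t = fwd_jump T t - t"

definition delta_deriv :: "real set \<Rightarrow> (real \<Rightarrow> real) \<Rightarrow> real \<Rightarrow> real" where
  "delta_deriv T f t = (f (fwd_jump T t) - f t) / graininess T t"

definition is_solution :: "real set \<Rightarrow> real \<Rightarrow> (real \<Rightarrow> real) \<Rightarrow> bool" where
  "is_solution T lam x \<longleftrightarrow> (\<forall>t\<in>T. delta_deriv T x t = lam * x t)"

definition regressive :: "real set \<Rightarrow> real \<Rightarrow> bool" where
  "regressive T lam \<longleftrightarrow> (\<forall>t\<in>T. 1 + lam * graininess T t \<noteq> 0)"

definition HUS_constant :: "real set \<Rightarrow> real \<Rightarrow> real \<Rightarrow> bool" where
  "HUS_constant T lam K \<longleftrightarrow> K > 0 \<and>
     (\<forall>\<epsilon>>0. \<forall>\<phi> :: real \<Rightarrow> real.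
        (\<forall>t\<in>T. \<bar>delta_deriv T \<phi> t - lam * \<phi> t\<bar> \<le> \<epsilon>) \<longrightarrow>
        (\<exists>x. is_solution T lam x \<and> (\<forall>t\<in>T. \<bar>\<phi> t - x t\<bar> \<le> K * \<epsilon>)))"

definition has_HUS :: "real set \<Rightarrow> real \<Rightarrow> bool" where
  "has_HUS T lam \<longleftrightarrow> (\<exists>K. HUS_constant T lam K)"

definition min_HUS_constant :: "real set \<Rightarrow> real \<Rightarrow> real \<Rightarrow> bool" where
  "min_HUS_constant T lam K \<longleftrightarrow>
     HUS_constant T lam K \<and> (\<forall>K'. HUS_constant T lam K' \<longrightarrow> K \<le> K')"

text \<open>
  Meaningful only if \<open>\<alpha>\<^sup>2 + \<beta>\<^sup>2 - 6 * \<alpha> * \<beta> \<ge> 0\<close>: the library extends \<^const>\<open>sqrt\<close> to an odd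
  function, so for a negative discriminant these are unrelated real numbers.
\<close>

definition lam_plus :: "real \<Rightarrow> real \<Rightarrow> real" where
  "lam_plus \<alpha> \<beta> = (- \<alpha> - \<beta> + sqrt (\<alpha>\<^sup>2 + \<beta>\<^sup>2 - 6 * \<alpha> * \<beta>)) / (2 * \<alpha> * \<beta>)"

definition lam_minus :: "real \<Rightarrow> real \<Rightarrow> real" where
  "lam_minus \<alpha> \<beta> = (- \<alpha> - \<beta> - sqrt (\<alpha>\<^sup>2 + \<beta>\<^sup>2 - 6 * \<alpha> * \<beta>)) / (2 * \<alpha> * \<beta>)"

lemma
  assumes "\<alpha> > 0" "\<beta> > 0"
  shows graininess_time_scale_1: "graininess (time_scale \<alpha> \<beta>) (real k * (\<alpha> + \<beta>)) = \<alpha>"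
    and graininess_time_scale_2: "graininess (time_scale \<alpha> \<beta>) (real k * (\<alpha> + \<beta>) + \<alpha>) = \<beta>"
proof -
  have mono: "real (Suc k) * (\<alpha> + \<beta>) \<le> real j * (\<alpha> + \<beta>)" if "k < j" for j
    using that assms by (intro mult_right_mono) auto
  have mono': "real j * (\<alpha> + \<beta>) \<le> real k * (\<alpha> + \<beta>)" if "j \<le> k" for j
    using that assms by (intro mult_right_mono) auto
  have suc: "real (Suc k) * (\<alpha> + \<beta>) = real k * (\<alpha> + \<beta>) + \<alpha> + \<beta>"
    by (simp add: algebra_simps)
  have "fwd_jump (time_scale \<alpha> \<beta>) (real k * (\<alpha> + \<beta>)) = real k * (\<alpha> + \<beta>) + \<alpha>"
    unfolding fwd_jump_def
  proof (rule Least_equality)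
    show "real k * (\<alpha> + \<beta>) + \<alpha> \<in> time_scale \<alpha> \<beta> \<and> real k * (\<alpha> + \<beta>) < real k * (\<alpha> + \<beta>) + \<alpha>"
      using assms unfolding time_scale_def by auto
  next
    fix s assume s: "s \<in> time_scale \<alpha> \<beta> \<and> real k * (\<alpha> + \<beta>) < s"
    then obtain j where j: "s = real j * (\<alpha> + \<beta>) \<or> s = real j * (\<alpha> + \<beta>) + \<alpha>"
      unfolding time_scale_def by blast
    consider "j < k" | "j = k" | "k < j" by linarith
    then show "real k * (\<alpha> + \<beta>) + \<alpha> \<le> s"
    proof cases
      case 1
      then have "real (Suc j) * (\<alpha> + \<beta>) \<le> real k * (\<alpha> + \<beta>)" by (intro mono') auto
      then have "real j * (\<alpha> + \<beta>) + \<alpha> + \<beta> \<le> real k * (\<alpha> + \<beta>)" by (simp add: algebra_simps)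
      with j s assms show ?thesis by linarith
    next
      case 2
      with j s assms show ?thesis by auto
    next
      case 3
      with j mono[of j] suc assms show ?thesis by linarith
    qed
  qed
  then show "graininess (time_scale \<alpha> \<beta>) (real k * (\<alpha> + \<beta>)) = \<alpha>"
    by (simp add: graininess_def)
  have "fwd_jump (time_scale \<alpha> \<beta>) (real k * (\<alpha> + \<beta>) + \<alpha>) = real (Suc k) * (\<alpha> + \<beta>)"
    unfolding fwd_jump_def
  proof (rule Least_equality)
    show "real (Suc k) * (\<alpha> + \<beta>) \<in> time_scale \<alpha> \<beta> \<and> real k * (\<alpha> + \<beta>) + \<alpha> < real (Suc k) * (\<alpha> + \<beta>)"
    proof
      show "real (Suc k) * (\<alpha> + \<beta>) \<in> time_scale \<alpha> \<beta>"
        unfolding time_scale_def by blast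
    qed (use suc assms in linarith)
  next
    fix s assume s: "s \<in> time_scale \<alpha> \<beta> \<and> real k * (\<alpha> + \<beta>) + \<alpha> < s"
    then obtain j where j: "s = real j * (\<alpha> + \<beta>) \<or> s = real j * (\<alpha> + \<beta>) + \<alpha>"
      unfolding time_scale_def by blast
    show "real (Suc k) * (\<alpha> + \<beta>) \<le> s"
    proof (cases "k < j")
      case True
      with j mono[of j] assms show ?thesis by linarith
    next
      case False
      with j mono'[of j] s assms show ?thesis by linarith
    qed
  qed
  with suc show "graininess (time_scale \<alpha> \<beta>) (real k * (\<alpha> + \<beta>) + \<alpha>) = \<beta>"
    by (simp add: graininess_def)
qed

end

theory Submission
  imports Defs
begin

text \<open>
  Put \<open>a = 1 + \<alpha> \<lambda>\<close> and \<open>b = 1 + \<beta> \<lambda>\<close>. Along the points of the time scale the equation multiplies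
  alternately by \<open>a\<close> and \<open>b\<close>, and a perturbation of size \<open>\<epsilon>\<close> adds an error of at most \<open>\<alpha> \<epsilon>\<close> or
  \<open>\<beta> \<epsilon>\<close>. Let \<open>P\<close> and \<open>Q\<close> be the two-periodic fixed point of the resulting error recursion,
  that is \<open>P = (\<bar>b\<bar> \<alpha> + \<beta>) / \<bar>1 - \<bar>a b\<bar>\<bar>\<close> and \<open>Q = (\<bar>a\<bar> \<beta> + \<alpha>) / \<bar>1 - \<bar>a b\<bar>\<bar>\<close>. If \<open>\<bar>a b\<bar> < 1\<close>, the
  solution with the same initial value stays within \<open>P \<epsilon>\<close> and \<open>Q \<epsilon>\<close> by induction. If \<open>\<bar>a b\<bar> > 1\<close>,
  the initial values of solutions that are this close up to the \<open>n\<close>-th point form nested compact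
  intervals, and a common point of these gives the solution. Hence \<open>max P Q\<close> is a Hyers-Ulam
  constant whenever \<open>\<bar>a b\<bar> \<noteq> 1\<close>, and the constants of the theorem are its values in the various
  sign patterns of \<open>a\<close>, \<open>b\<close> and \<open>\<bar>a b\<bar> - 1\<close>. If \<open>\<bar>a b\<bar> = 1\<close>, a resonant perturbation grows linearly.
\<close>

section \<open>Enumeration of the time scale and reduction to two-periodic recurrences\<close>

definition point :: "real \<Rightarrow> real \<Rightarrow> nat \<Rightarrow> real" where
  "point \<alpha> \<beta> n = real (n div 2) * (\<alpha> + \<beta>) + (if even n then 0 else \<alpha>)"

definition step :: "real \<Rightarrow> real \<Rightarrow> nat \<Rightarrow> real" where
  "step \<alpha> \<beta> n = (if even n then \<alpha> else \<beta>)"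

lemma step_pos: "\<alpha> > 0 \<Longrightarrow> \<beta> > 0 \<Longrightarrow> step \<alpha> \<beta> n > 0"
  by (simp add: step_def)

lemma point_Suc: "point \<alpha> \<beta> (Suc n) = point \<alpha> \<beta> n + step \<alpha> \<beta> n"
  by (auto simp: point_def step_def algebra_simps elim!: evenE oddE)

lemma inj_point:
  assumes "\<alpha> > 0" "\<beta> > 0"
  shows "inj (point \<alpha> \<beta>)"
proof -
  have "strict_mono (point \<alpha> \<beta>)"
    using step_pos[OF assms] by (simp add: strict_mono_Suc_iff point_Suc)
  then show ?thesis
    by (rule strict_mono_imp_inj_on)
qed

lemma time_scale_eq_range_point: "time_scale \<alpha> \<beta> = range (point \<alpha> \<beta>)"
proof (intro set_eqI iffI)
  fix t assume "t \<in> time_scale \<alpha> \<beta>"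
  then obtain k :: nat where "t = real k * (\<alpha> + \<beta>) \<or> t = real k * (\<alpha> + \<beta>) + \<alpha>"
    by (auto simp: time_scale_def)
  then have "t = point \<alpha> \<beta> (2 * k) \<or> t = point \<alpha> \<beta> (Suc (2 * k))"
    by (auto simp: point_def)
  then show "t \<in> range (point \<alpha> \<beta>)" by blast
next
  fix t assume "t \<in> range (point \<alpha> \<beta>)"
  then show "t \<in> time_scale \<alpha> \<beta>"
    by (auto simp: point_def time_scale_def)
qed

lemma graininess_point:
  assumes "\<alpha> > 0" "\<beta> > 0"
  shows "graininess (time_scale \<alpha> \<beta>) (point \<alpha> \<beta> n) = step \<alpha> \<beta> n"
  using graininess_time_scale_1[OF assms, of "n div 2"] graininess_time_scale_2[OF assms, of "n div 2"]
  by (auto simp: point_def step_def)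

lemma delta_deriv_point:
  assumes "\<alpha> > 0" "\<beta> > 0"
  shows "delta_deriv (time_scale \<alpha> \<beta>) f (point \<alpha> \<beta> n) =
    (f (point \<alpha> \<beta> (Suc n)) - f (point \<alpha> \<beta> n)) / step \<alpha> \<beta> n"
proof -
  have "fwd_jump (time_scale \<alpha> \<beta>) (point \<alpha> \<beta> n) = point \<alpha> \<beta> (Suc n)"
    using graininess_point[OF assms, of n] by (simp add: graininess_def point_Suc)
  then show ?thesis
    by (simp add: delta_deriv_def graininess_point[OF assms])
qed

text \<open>Functions on the time scale are total functions on the reals, so a sequence has to be
  extended. Injectivity of \<open>point\<close> makes \<open>inv\<close> recover the index; the
  values elsewhere are irrelevant.\<close>

lemma ex_fun_point:
  assumes "\<alpha> > 0" "\<beta> > 0"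
  obtains f :: "real \<Rightarrow> real" where "\<And>n. f (point \<alpha> \<beta> n) = u n"
  using inv_f_f[OF inj_point[OF assms]] that[of "\<lambda>t. u (inv (point \<alpha> \<beta>) t)"] by simp

lemma is_solution_iff:
  assumes "\<alpha> > 0" "\<beta> > 0"
  shows "is_solution (time_scale \<alpha> \<beta>) lam x \<longleftrightarrow>
    (\<forall>n. x (point \<alpha> \<beta> (Suc n)) = (1 + lam * step \<alpha> \<beta> n) * x (point \<alpha> \<beta> n))"
proof -
  have "delta_deriv (time_scale \<alpha> \<beta>) x (point \<alpha> \<beta> n) = lam * x (point \<alpha> \<beta> n) \<longleftrightarrow>
    x (point \<alpha> \<beta> (Suc n)) = (1 + lam * step \<alpha> \<beta> n) * x (point \<alpha> \<beta> n)" for n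
    using step_pos[OF assms, of n] unfolding delta_deriv_point[OF assms]
    by (auto simp: field_simps)
  then show ?thesis
    by (auto simp: is_solution_def time_scale_eq_range_point)
qed

text \<open>Multiplying the defect of the equation by the positive graininess gives the one-step
  error of the recurrence. This is why an error carries the weight \<alpha> or \<beta>.\<close>

lemma perturbed_point_iff:
  assumes "\<alpha> > 0" "\<beta> > 0"
  shows "\<bar>delta_deriv (time_scale \<alpha> \<beta>) f (point \<alpha> \<beta> n) - lam * f (point \<alpha> \<beta> n)\<bar> \<le> \<epsilon> \<longleftrightarrow>
    \<bar>f (point \<alpha> \<beta> (Suc n)) - (1 + lam * step \<alpha> \<beta> n) * f (point \<alpha> \<beta> n)\<bar> \<le> step \<alpha> \<beta> n * \<epsilon>"
proof -
  have pos: "step \<alpha> \<beta> n > 0" by (rule step_pos[OF assms])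
  have "delta_deriv (time_scale \<alpha> \<beta>) f (point \<alpha> \<beta> n) - lam * f (point \<alpha> \<beta> n) =
    (f (point \<alpha> \<beta> (Suc n)) - (1 + lam * step \<alpha> \<beta> n) * f (point \<alpha> \<beta> n)) / step \<alpha> \<beta> n"
    using pos unfolding delta_deriv_point[OF assms] by (simp add: field_simps)
  then show ?thesis
    using pos by (simp add: abs_divide pos_divide_le_eq mult.commute)
qed

text \<open>Functions on the time scale and sequences correspond through \<open>point\<close>, for
  approximate and for exact solutions. This lets the stability estimates be carried out for
  recurrences.\<close>

lemma HUS_constant_iff:
  assumes "\<alpha> > 0" "\<beta> > 0"
  shows "HUS_constant (time_scale \<alpha> \<beta>) lam K \<longleftrightarrow> K > 0 \<and>
    (\<forall>\<epsilon>>0. \<forall>u.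
      (\<forall>n. \<bar>u (Suc n) - (1 + lam * step \<alpha> \<beta> n) * u n\<bar> \<le> step \<alpha> \<beta> n * \<epsilon>) \<longrightarrow>
      (\<exists>y. (\<forall>n. y (Suc n) = (1 + lam * step \<alpha> \<beta> n) * y n) \<and> (\<forall>n. \<bar>u n - y n\<bar> \<le> K * \<epsilon>)))"
    (is "_ \<longleftrightarrow> K > 0 \<and> ?R")
proof -
  let ?T = "time_scale \<alpha> \<beta>" and ?p = "point \<alpha> \<beta>" and ?c = "\<lambda>n. 1 + lam * step \<alpha> \<beta> n"
  have "?R" if H: "HUS_constant ?T lam K"
  proof (intro allI impI)
    fix \<epsilon> :: real and u
    assume \<epsilon>: "\<epsilon> > 0" and u: "\<forall>n. \<bar>u (Suc n) - ?c n * u n\<bar> \<le> step \<alpha> \<beta> n * \<epsilon>"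
    obtain f where f: "\<And>n. f (?p n) = u n" using ex_fun_point[OF assms] by blast
    have "\<bar>delta_deriv ?T f (?p n) - lam * f (?p n)\<bar> \<le> \<epsilon>" for n
      using u perturbed_point_iff[OF assms, of f n lam \<epsilon>] by (simp add: f)
    then have "\<forall>t\<in>?T. \<bar>delta_deriv ?T f t - lam * f t\<bar> \<le> \<epsilon>"
      by (metis rangeE time_scale_eq_range_point)
    with H \<epsilon> obtain x where x: "is_solution ?T lam x" "\<forall>t\<in>?T. \<bar>f t - x t\<bar> \<le> K * \<epsilon>"
      unfolding HUS_constant_def by blast
    show "\<exists>y. (\<forall>n. y (Suc n) = ?c n * y n) \<and> (\<forall>n. \<bar>u n - y n\<bar> \<le> K * \<epsilon>)"
    proof (intro exI[of _ "\<lambda>n. x (?p n)"] conjI allI)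
      show "x (?p (Suc n)) = ?c n * x (?p n)" for n
        using x(1) unfolding is_solution_iff[OF assms] by blast
      show "\<bar>u n - x (?p n)\<bar> \<le> K * \<epsilon>" for n
        using x(2) by (metis f rangeI time_scale_eq_range_point)
    qed
  qed
  moreover have "HUS_constant ?T lam K" if "K > 0" and R: ?R
    unfolding HUS_constant_def
  proof (intro conjI allI impI \<open>K > 0\<close>)
    fix \<epsilon> :: real and f
    assume \<epsilon>: "\<epsilon> > 0" and f: "\<forall>t\<in>?T. \<bar>delta_deriv ?T f t - lam * f t\<bar> \<le> \<epsilon>"
    have "\<forall>n. \<bar>f (?p (Suc n)) - ?c n * f (?p n)\<bar> \<le> step \<alpha> \<beta> n * \<epsilon>"
      using f perturbed_point_iff[OF assms] time_scale_eq_range_point by blast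
    with R[rule_format, of \<epsilon> "\<lambda>n. f (?p n)"] \<epsilon> obtain y
      where y: "\<forall>n. y (Suc n) = ?c n * y n" "\<forall>n. \<bar>f (?p n) - y n\<bar> \<le> K * \<epsilon>"
      by blast
    obtain x where x: "\<And>n. x (?p n) = y n" using ex_fun_point[OF assms] by blast
    show "\<exists>x. is_solution ?T lam x \<and> (\<forall>t\<in>?T. \<bar>f t - x t\<bar> \<le> K * \<epsilon>)"
    proof (intro exI[of _ x] conjI ballI)
      show "is_solution ?T lam x"
        using x y(1) by (simp add: is_solution_iff[OF assms])
      show "\<bar>f t - x t\<bar> \<le> K * \<epsilon>" if "t \<in> ?T" for t
        using that x y(2) by (auto simp: time_scale_eq_range_point)
    qed
  qed
  ultimately show ?thesis
    by (auto simp: HUS_constant_def)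
qed

section \<open>Exact solutions close to a perturbed first-order linear recurrence\<close>

text \<open>The solution with initial value \<open>u 0\<close> works: its distance to
  \<open>u\<close> is multiplied by at most \<open>\<bar>c n\<bar>\<close> and increased by at most
  \<open>h n\<close> in each step, and \<open>w\<close> dominates this recursion.\<close>

lemma shadow_contracting:
  fixes u c h w :: "nat \<Rightarrow> real"
  assumes u: "\<And>n. \<bar>u (Suc n) - c n * u n\<bar> \<le> h n"
    and w: "\<And>n. \<bar>c n\<bar> * w n + h n \<le> w (Suc n)" and "w 0 \<ge> 0"
  shows "\<exists>y. (\<forall>n. y (Suc n) = c n * y n) \<and> (\<forall>n. \<bar>u n - y n\<bar> \<le> w n)"
proof -
  define y where "y = rec_nat (u 0) (\<lambda>n z. c n * z)"
  have y: "y 0 = u 0" "y (Suc n) = c n * y n" for n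
    by (simp_all add: y_def)
  have "\<bar>u n - y n\<bar> \<le> w n" for n
  proof (induction n)
    case 0
    then show ?case using y \<open>w 0 \<ge> 0\<close> by simp
  next
    case (Suc n)
    have "u (Suc n) - y (Suc n) = (u (Suc n) - c n * u n) + c n * (u n - y n)"
      by (simp add: y algebra_simps)
    then have "\<bar>u (Suc n) - y (Suc n)\<bar> \<le> h n + \<bar>c n\<bar> * \<bar>u n - y n\<bar>"
      using u[of n] by (metis abs_mult abs_triangle_ineq add_right_mono order_trans)
    also have "\<dots> \<le> h n + \<bar>c n\<bar> * w n"
      using Suc by (intro add_left_mono mult_left_mono) auto
    finally show ?case using w[of n] by linarith
  qed
  with y show ?thesis by blast
qed

text \<open>The supremum of the left endpoints is a common point, because every left endpoint lies
  below every right one, as a comparison at the larger of the two indices shows.\<close>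

lemma nested_intervals:
  fixes l r :: "nat \<Rightarrow> real"
  assumes "incseq l" "decseq r" and le: "\<And>n. l n \<le> r n"
  shows "\<exists>z. \<forall>n. l n \<le> z \<and> z \<le> r n"
proof (intro exI allI conjI)
  have lr: "l m \<le> r n" for m n
    using incseqD[OF assms(1), of m "max m n"] decseqD[OF assms(2), of n "max m n"] le[of "max m n"]
    by simp
  then have "bdd_above (range l)" by (intro bdd_aboveI) auto
  then show "l n \<le> (SUP m. l m)" for n by (rule cSUP_upper2) auto
  show "(SUP m. l m) \<le> r n" for n by (rule cSUP_least) (use lr in auto)
qed

text \<open>Errors are pulled back to the start instead of being propagated forward. With
  \<open>p n\<close> the product of the first \<open>n\<close> coefficients, the admissible initial
  values at index \<open>n\<close> form the interval with centre \<open>u n / p n\<close> and radius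
  \<open>w n / \<bar>p n\<bar>\<close>. The condition on \<open>w\<close> makes these intervals
  nested, and a common point is the initial value sought.\<close>

lemma shadow_expanding:
  fixes u c h w :: "nat \<Rightarrow> real"
  assumes u: "\<And>n. \<bar>u (Suc n) - c n * u n\<bar> \<le> h n"
    and w: "\<And>n. w (Suc n) + h n \<le> \<bar>c n\<bar> * w n" and w0: "\<And>n. w n \<ge> 0" and c: "\<And>n. c n \<noteq> 0"
  shows "\<exists>y. (\<forall>n. y (Suc n) = c n * y n) \<and> (\<forall>n. \<bar>u n - y n\<bar> \<le> w n)"
proof -
  define p where "p n = (\<Prod>i<n. c i)" for n
  have p0: "p n \<noteq> 0" for n using c by (simp add: p_def)
  have pS: "p (Suc n) = c n * p n" for n by (simp add: p_def mult.commute)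
  \<comment> \<open>Nestedness: the shift of the centre plus the new radius is at most the old
    radius.\<close>
  have key: "\<bar>u (Suc n) / p (Suc n) - u n / p n\<bar> + w (Suc n) / \<bar>p (Suc n)\<bar> \<le> w n / \<bar>p n\<bar>" for n
  proof -
    have "u (Suc n) / p (Suc n) - u n / p n = (u (Suc n) - c n * u n) / p (Suc n)"
      using p0[of n] c[of n] by (simp add: pS field_simps)
    then have "\<bar>u (Suc n) / p (Suc n) - u n / p n\<bar> + w (Suc n) / \<bar>p (Suc n)\<bar> =
      (\<bar>u (Suc n) - c n * u n\<bar> + w (Suc n)) / \<bar>p (Suc n)\<bar>"
      by (simp add: abs_divide add_divide_distrib)
    also have "\<dots> \<le> (\<bar>c n\<bar> * w n) / \<bar>p (Suc n)\<bar>"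
      using u[of n] w[of n] by (intro divide_right_mono) auto
    also have "\<dots> = w n / \<bar>p n\<bar>"
      using c[of n] by (simp add: pS abs_mult)
    finally show ?thesis .
  qed
  have "\<exists>z. \<forall>n. u n / p n - w n / \<bar>p n\<bar> \<le> z \<and> z \<le> u n / p n + w n / \<bar>p n\<bar>"
  proof (rule nested_intervals)
    show "incseq (\<lambda>n. u n / p n - w n / \<bar>p n\<bar>)" "decseq (\<lambda>n. u n / p n + w n / \<bar>p n\<bar>)"
      by (rule incseq_SucI decseq_SucI, use key in \<open>smt (verit)\<close>)+
    show "u n / p n - w n / \<bar>p n\<bar> \<le> u n / p n + w n / \<bar>p n\<bar>" for n
      using w0[of n] divide_nonneg_nonneg[of "w n" "\<bar>p n\<bar>"] by simp
  qed
  then obtain z where "\<And>n. u n / p n - w n / \<bar>p n\<bar> \<le> z \<and> z \<le> u n / p n + w n / \<bar>p n\<bar>"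
    by blast
  then have z: "\<bar>u n / p n - z\<bar> \<le> w n / \<bar>p n\<bar>" for n
    by (smt (verit))
  have "\<bar>u n - z * p n\<bar> \<le> w n" for n
  proof -
    have "u n - z * p n = (u n / p n - z) * p n"
      using p0[of n] by (simp add: field_simps)
    then have "\<bar>u n - z * p n\<bar> = \<bar>u n / p n - z\<bar> * \<bar>p n\<bar>"
      by (simp add: abs_mult)
    also have "\<dots> \<le> w n / \<bar>p n\<bar> * \<bar>p n\<bar>"
      by (intro mult_right_mono z) simp
    finally show ?thesis using p0[of n] by simp
  qed
  then show ?thesis
    by (intro exI[of _ "\<lambda>n. z * p n"]) (simp add: pS)
qed

section \<open>Stability off resonance, instability at resonance, and a lower bound for the
  constants\<close>

lemma HUS_constant_time_scale:
  fixes \<alpha> \<beta> lam :: real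
  defines "a \<equiv> 1 + \<alpha> * lam" and "b \<equiv> 1 + \<beta> * lam"
  assumes pos: "\<alpha> > 0" "\<beta> > 0" and ab: "\<bar>a * b\<bar> \<noteq> 1"
  shows "HUS_constant (time_scale \<alpha> \<beta>) lam
    (max (\<bar>b\<bar> * \<alpha> + \<beta>) (\<bar>a\<bar> * \<beta> + \<alpha>) / \<bar>1 - \<bar>a * b\<bar>\<bar>)"
    (is "HUS_constant _ _ ?K")
proof -
  define D where "D = \<bar>1 - \<bar>a * b\<bar>\<bar>"
  define P where "P = (\<bar>b\<bar> * \<alpha> + \<beta>) / D"
  define Q where "Q = (\<bar>a\<bar> * \<beta> + \<alpha>) / D"
  have D: "D > 0" using ab by (simp add: D_def)
  have PQ: "P > 0" "Q > 0"
    using pos D by (auto simp: P_def Q_def intro!: divide_pos_pos add_nonneg_pos)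
  have PD: "P * D = \<bar>b\<bar> * \<alpha> + \<beta>" "Q * D = \<bar>a\<bar> * \<beta> + \<alpha>"
    using D by (simp_all add: P_def Q_def)
  have K: "?K = max P Q"
    using D by (simp add: P_def Q_def D_def max_divide_distrib_right)
  \<comment> \<open>The bound depends on the parity of the index; only at the end is it replaced by
    the uniform \<open>max P Q\<close>.\<close>
  define w where "w n = (if even n then P else Q)" for n :: nat
  define c where "c n = 1 + lam * step \<alpha> \<beta> n" for n
  have c_eq: "c n = (if even n then a else b)" for n
    by (simp add: c_def step_def a_def b_def mult.commute)
  show ?thesis
    unfolding K HUS_constant_iff[OF pos] c_def[symmetric]
  proof (intro conjI allI impI)
    show "max P Q > 0" using PQ by simp
    fix \<epsilon> :: real and u :: "nat \<Rightarrow> real"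
    assume \<epsilon>: "\<epsilon> > 0" and u: "\<forall>n. \<bar>u (Suc n) - c n * u n\<bar> \<le> step \<alpha> \<beta> n * \<epsilon>"
    have "\<exists>y. (\<forall>n. y (Suc n) = c n * y n) \<and> (\<forall>n. \<bar>u n - y n\<bar> \<le> w n * \<epsilon>)"
    proof (cases "\<bar>a * b\<bar> < 1")
      case True
      then have "D = 1 - \<bar>a\<bar> * \<bar>b\<bar>" by (simp add: D_def abs_mult)
      \<comment> \<open>Multiplied by \<open>D\<close>, the fixed-point equations are polynomial
        consequences of \<open>PD\<close>.\<close>
      then have "(\<bar>a\<bar> * P + \<alpha>) * D = Q * D" "(\<bar>b\<bar> * Q + \<beta>) * D = P * D"
        using PD by algebra+
      then have "\<bar>a\<bar> * P + \<alpha> = Q" "\<bar>b\<bar> * Q + \<beta> = P"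
        using D by simp_all
      then have w: "\<bar>c n\<bar> * w n + step \<alpha> \<beta> n = w (Suc n)" for n
        by (simp add: w_def c_eq step_def)
      show ?thesis
        using u \<epsilon> PQ
        by (intro shadow_contracting[where h = "\<lambda>n. step \<alpha> \<beta> n * \<epsilon>"])
          (auto simp: w[symmetric] algebra_simps, simp add: w_def)
    next
      case False
      then have "D = \<bar>a\<bar> * \<bar>b\<bar> - 1" by (simp add: D_def abs_mult)
      \<comment> \<open>The sign change of \<open>1 - \<bar>a * b\<bar>\<close> is what makes the
        same \<open>P\<close> and \<open>Q\<close> satisfy the backward recursion, with the errors
        now subtracted.\<close>
      then have "\<bar>a\<bar> * P * D = (Q + \<alpha>) * D" "\<bar>b\<bar> * Q * D = (P + \<beta>) * D"
        using PD by algebra+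
      then have "\<bar>a\<bar> * P = Q + \<alpha>" "\<bar>b\<bar> * Q = P + \<beta>"
        using D by simp_all
      then have w: "\<bar>c n\<bar> * w n = w (Suc n) + step \<alpha> \<beta> n" for n
        by (simp add: w_def c_eq step_def)
      have "a \<noteq> 0" "b \<noteq> 0" using False by auto
      then have "c n \<noteq> 0" for n by (simp add: c_eq)
      moreover have "w n \<ge> 0" for n using PQ by (simp add: w_def)
      moreover have "w (Suc n) * \<epsilon> + step \<alpha> \<beta> n * \<epsilon> \<le> \<bar>c n\<bar> * (w n * \<epsilon>)" for n
        using w[of n] by (simp add: mult.assoc[symmetric] distrib_right)
      ultimately show ?thesis
        using u \<epsilon> by (intro shadow_expanding[where h = "\<lambda>n. step \<alpha> \<beta> n * \<epsilon>"]) auto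
    qed
    then obtain y where y: "\<forall>n. y (Suc n) = c n * y n" "\<And>n. \<bar>u n - y n\<bar> \<le> w n * \<epsilon>"
      by blast
    have "w n * \<epsilon> \<le> max P Q * \<epsilon>" for n
      using \<epsilon> by (intro mult_right_mono) (auto simp: w_def)
    with y show "\<exists>y. (\<forall>n. y (Suc n) = c n * y n) \<and> (\<forall>n. \<bar>u n - y n\<bar> \<le> max P Q * \<epsilon>)"
      using order_trans by blast
  qed
qed

lemma solution_even:
  fixes y :: "nat \<Rightarrow> real"
  assumes "\<And>n. y (Suc n) = (1 + lam * step \<alpha> \<beta> n) * y n"
  shows "y (2 * k) = ((1 + \<alpha> * lam) * (1 + \<beta> * lam)) ^ k * y 0"
  by (induction k) (simp_all add: assms step_def mult_ac)

lemma not_has_HUS_of_resonance: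
  fixes \<alpha> \<beta> lam :: real
  assumes pos: "\<alpha> > 0" "\<beta> > 0" and ab: "\<bar>(1 + \<alpha> * lam) * (1 + \<beta> * lam)\<bar> = 1"
  shows "\<not> has_HUS (time_scale \<alpha> \<beta>) lam"
proof
  define a where "a = 1 + \<alpha> * lam"
  define b where "b = 1 + \<beta> * lam"
  have ab: "\<bar>a * b\<bar> = 1" using ab by (simp add: a_def b_def)
  assume "has_HUS (time_scale \<alpha> \<beta>) lam"
  then obtain K where K: "HUS_constant (time_scale \<alpha> \<beta>) lam K"
    unfolding has_HUS_def by blast
  \<comment> \<open>An approximate solution for \<epsilon> = 1. The recurrence is exact at even
    indices, and each odd index adds an error of size \<beta> in phase with the solution
    \<open>(a * b) ^ k\<close>, so these errors never cancel.\<close>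
  define u where "u n = (if even n then 1 else a) * (a * b) ^ (n div 2) * real (n div 2) * \<beta>" for n
  have "\<bar>u (Suc n) - (1 + lam * step \<alpha> \<beta> n) * u n\<bar> \<le> step \<alpha> \<beta> n * 1" for n
  proof (cases "even n")
    case True
    then have "u (Suc n) - (1 + lam * step \<alpha> \<beta> n) * u n = 0"
      by (simp add: u_def step_def a_def mult_ac)
    then show ?thesis using step_pos[OF pos, of n] by simp
  next
    case False
    then obtain k where k: "n = 2 * k + 1" by (elim oddE)
    have "u (Suc n) - (1 + lam * step \<alpha> \<beta> n) * u n = (a * b) ^ Suc k * \<beta>"
      by (simp add: k u_def step_def b_def algebra_simps)
    then show ?thesis
      using pos False by (simp add: abs_mult power_abs ab[unfolded abs_mult] step_def del: power_Suc)
  qed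
  with K obtain y where y: "\<And>n. y (Suc n) = (1 + lam * step \<alpha> \<beta> n) * y n"
    and d: "\<And>n. \<bar>u n - y n\<bar> \<le> K"
    unfolding HUS_constant_iff[OF pos] by (metis mult.right_neutral zero_less_one)
  \<comment> \<open>The common factor \<open>(a * b) ^ k\<close> has modulus 1, so the distance at
    the even points is that of a linearly growing term from a constant.\<close>
  have "\<bar>real k * \<beta> - y 0\<bar> \<le> K" for k
  proof -
    have "u (2 * k) - y (2 * k) = (a * b) ^ k * (real k * \<beta> - y 0)"
      using solution_even[of y, OF y, of k] by (simp add: u_def a_def b_def algebra_simps)
    then show ?thesis
      using d[of "2 * k"] by (simp add: abs_mult power_abs ab[unfolded abs_mult])
  qed
  moreover obtain k where "(K + \<bar>y 0\<bar>) / \<beta> < real k"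
    using reals_Archimedean2 by blast
  then have "K + \<bar>y 0\<bar> < real k * \<beta>"
    using pos by (simp add: divide_less_eq)
  ultimately show False by (smt (verit))
qed

text \<open>The constant function \<open>1 / \<bar>\<lambda>\<bar>\<close> is an approximate solution for \<open>\<epsilon> = 1\<close>, and a solution at bounded
  distance from it either vanishes or tends to \<open>0\<close>.\<close>
lemma HUS_constant_ge_inverse:
  fixes \<alpha> \<beta> lam :: real
  assumes pos: "\<alpha> > 0" "\<beta> > 0" and lam: "lam \<noteq> 0"
    and ab: "\<bar>(1 + \<alpha> * lam) * (1 + \<beta> * lam)\<bar> \<noteq> 1"
    and K: "HUS_constant (time_scale \<alpha> \<beta>) lam K"
  shows "1 / \<bar>lam\<bar> \<le> K"
proof -
  define q where "q = (1 + \<alpha> * lam) * (1 + \<beta> * lam)"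
  have "\<bar>1 / \<bar>lam\<bar> - (1 + lam * step \<alpha> \<beta> n) * (1 / \<bar>lam\<bar>)\<bar> \<le> step \<alpha> \<beta> n * 1" for n
  proof -
    have "1 / \<bar>lam\<bar> - (1 + lam * step \<alpha> \<beta> n) * (1 / \<bar>lam\<bar>) = - (lam / \<bar>lam\<bar>) * step \<alpha> \<beta> n"
      using lam by (simp add: field_simps)
    then show ?thesis
      using lam step_pos[OF pos, of n] by (simp add: abs_mult abs_divide)
  qed
  from K[unfolded HUS_constant_iff[OF pos], THEN conjunct2, rule_format,
      of 1 "\<lambda>n. 1 / \<bar>lam\<bar>", OF zero_less_one this]
  obtain y where y: "\<And>n. y (Suc n) = (1 + lam * step \<alpha> \<beta> n) * y n"
    and d: "\<And>n. \<bar>1 / \<bar>lam\<bar> - y n\<bar> \<le> K"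
    unfolding mult_1_right by blast
  have d: "\<bar>1 / \<bar>lam\<bar> - q ^ k * y 0\<bar> \<le> K" for k
    using d[of "2 * k"] solution_even[of y, OF y, of k] by (simp add: q_def)
  show ?thesis
  proof (cases "\<bar>q\<bar> < 1")
    case True
    then have "(\<lambda>k. \<bar>1 / \<bar>lam\<bar> - q ^ k * y 0\<bar>) \<longlonglongrightarrow> \<bar>1 / \<bar>lam\<bar> - 0 * y 0\<bar>"
      by (intro tendsto_intros LIMSEQ_power_zero) simp
    from LIMSEQ_le_const2[OF this] d show ?thesis by auto
  next
    case False
    then have q: "\<bar>q\<bar> > 1" using ab by (simp add: q_def)
    have "y 0 = 0"
    proof (rule ccontr)
      assume "y 0 \<noteq> 0"
      obtain k where "(K + 1 / \<bar>lam\<bar>) / \<bar>y 0\<bar> < \<bar>q\<bar> ^ k"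
        using real_arch_pow[OF q] by blast
      then have "K + 1 / \<bar>lam\<bar> < \<bar>q ^ k * y 0\<bar>"
        using \<open>y 0 \<noteq> 0\<close> by (simp add: divide_less_eq abs_mult power_abs)
      moreover have "1 / \<bar>lam\<bar> \<ge> 0" by simp
      ultimately show False using d[of k] by linarith
    qed
    with d[of 0] show ?thesis by simp
  qed
qed

section \<open>Explicit constants for each sign pattern of the two factors\<close>

text \<open>With \<open>?a\<close> and \<open>?b\<close> the two factors,
  \<open>\<alpha> * \<beta> * F\<close> equals \<open>?a * ?b + 1\<close>, which is
  \<open>1 - \<bar>?a * ?b\<bar>\<close> when the signs differ. So \<open>F\<close> measures the
  distance from resonance, whether or not it has real roots in \<open>lam\<close>.\<close>

lemma HUS_constant_opposite_signs:
  fixes \<alpha> \<beta> lam :: real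
  defines "F \<equiv> (2 + \<alpha> * lam + \<beta> * lam + \<alpha> * \<beta> * lam\<^sup>2) / (\<alpha> * \<beta>)"
  assumes pos: "\<alpha> > 0" "\<beta> > 0" and F: "F \<noteq> 0"
  shows "- 1 / \<beta> < lam \<Longrightarrow> lam < - 1 / \<alpha> \<Longrightarrow>
      HUS_constant (time_scale \<alpha> \<beta>) lam (\<bar>lam + 1 / \<alpha> - 1 / \<beta>\<bar> / \<bar>F\<bar>)"
    and "- 1 / \<alpha> < lam \<Longrightarrow> lam < - 1 / \<beta> \<Longrightarrow>
      HUS_constant (time_scale \<alpha> \<beta>) lam ((1 / \<alpha> - 1 / \<beta> - lam) / \<bar>F\<bar>)"
proof -
  let ?a = "1 + \<alpha> * lam" and ?b = "1 + \<beta> * lam"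
  have F_eq: "\<alpha> * \<beta> * F = ?a * ?b + 1"
    using pos by (simp add: F_def field_simps power2_eq_square)
  have *: "HUS_constant (time_scale \<alpha> \<beta>) lam
      (max (\<bar>?b\<bar> * \<alpha> + \<beta>) (\<bar>?a\<bar> * \<beta> + \<alpha>) / (\<alpha> * \<beta>) / \<bar>F\<bar>)" if "?a * ?b < 0"
  proof -
    have "1 - \<bar>?a * ?b\<bar> = \<alpha> * \<beta> * F"
      using that F_eq by simp
    moreover from this have "\<bar>?a * ?b\<bar> \<noteq> 1"
      using F pos by auto
    ultimately show ?thesis
      using HUS_constant_time_scale[OF pos, of lam] pos by (simp add: abs_mult)
  qed
  show "HUS_constant (time_scale \<alpha> \<beta>) lam (\<bar>lam + 1 / \<alpha> - 1 / \<beta>\<bar> / \<bar>F\<bar>)"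
    if "- 1 / \<beta> < lam" "lam < - 1 / \<alpha>"
  proof -
    have a: "?a < 0" and b: "?b > 0"
      using that pos by (simp_all add: field_simps)
    \<comment> \<open>This decides the maximum: the second numerator exceeds the first by
      \<open>- 2 * \<beta> * ?a\<close>, which is positive.\<close>
    have "\<beta> + \<alpha> * (\<beta> * lam) < 0"
      using mult_strict_left_mono[OF a pos(2)] by (simp add: algebra_simps)
    moreover have "\<alpha> + \<alpha> * (\<beta> * lam) > 0"
      using mult_strict_left_mono[OF b pos(1)] by (simp add: algebra_simps)
    moreover have "\<bar>?b\<bar> * \<alpha> + \<beta> = \<alpha> + \<beta> + \<alpha> * (\<beta> * lam)" "\<bar>?a\<bar> * \<beta> + \<alpha> = \<alpha> - \<beta> - \<alpha> * (\<beta> * lam)"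
      unfolding abs_of_neg[OF a] abs_of_pos[OF b] by (simp_all add: algebra_simps)
    ultimately have "max (\<bar>?b\<bar> * \<alpha> + \<beta>) (\<bar>?a\<bar> * \<beta> + \<alpha>) = \<alpha> - \<beta> - \<alpha> * \<beta> * lam"
      by simp
    moreover have "1 / \<beta> > 0" "lam + 1 / \<alpha> < 0"
      using pos that by simp_all
    then have "\<bar>lam + 1 / \<alpha> - 1 / \<beta>\<bar> = 1 / \<beta> - 1 / \<alpha> - lam"
      by linarith
    then have "\<bar>lam + 1 / \<alpha> - 1 / \<beta>\<bar> = (\<alpha> - \<beta> - \<alpha> * \<beta> * lam) / (\<alpha> * \<beta>)"
      using pos by (simp add: field_simps)
    ultimately show ?thesis
      using * a b by (simp add: mult_neg_pos)
  qed
  show "HUS_constant (time_scale \<alpha> \<beta>) lam ((1 / \<alpha> - 1 / \<beta> - lam) / \<bar>F\<bar>)"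
    if "- 1 / \<alpha> < lam" "lam < - 1 / \<beta>"
  proof -
    have a: "?a > 0" and b: "?b < 0"
      using that pos by (simp_all add: field_simps)
    have "\<beta> + \<alpha> * (\<beta> * lam) > 0"
      using mult_strict_left_mono[OF a pos(2)] by (simp add: algebra_simps)
    \<comment> \<open>Here the first numerator exceeds the second by
      \<open>- 2 * \<alpha> * ?b\<close>, which is positive.\<close>
    moreover have "\<alpha> + \<alpha> * (\<beta> * lam) < 0"
      using mult_strict_left_mono[OF b pos(1)] by (simp add: algebra_simps)
    moreover have "\<bar>?b\<bar> * \<alpha> + \<beta> = \<beta> - \<alpha> - \<alpha> * (\<beta> * lam)" "\<bar>?a\<bar> * \<beta> + \<alpha> = \<alpha> + \<beta> + \<alpha> * (\<beta> * lam)"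
      unfolding abs_of_pos[OF a] abs_of_neg[OF b] by (simp_all add: algebra_simps)
    ultimately have "max (\<bar>?b\<bar> * \<alpha> + \<beta>) (\<bar>?a\<bar> * \<beta> + \<alpha>) = \<beta> - \<alpha> - \<alpha> * \<beta> * lam"
      by simp
    moreover have "1 / \<alpha> - 1 / \<beta> - lam = (\<beta> - \<alpha> - \<alpha> * \<beta> * lam) / (\<alpha> * \<beta>)"
      using pos by (simp add: field_simps)
    ultimately show ?thesis
      using * a b by (simp add: mult_pos_neg)
  qed
qed

text \<open>The product of the factors minus 1 is \<open>\<alpha> * \<beta> * lam * (lam + 1 /
  \<alpha> + 1 / \<beta>)\<close>. Since \<open>lam\<close> is negative, the sign of the last term
  separates contraction from expansion; the absolute value covers both, and the excluded
  \<open>lam\<close> is the resonant one.\<close>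

lemma HUS_constant_both_negative:
  fixes \<alpha> \<beta> lam :: real
  assumes pos: "\<alpha> > 0" "\<beta> > 0" and lam: "lam < - 1 / \<alpha>" "lam < - 1 / \<beta>"
    and ne: "lam \<noteq> - 1 / \<alpha> - 1 / \<beta>"
  shows "HUS_constant (time_scale \<alpha> \<beta>) lam
    (max (1 / \<beta> - 1 / \<alpha> - lam) (1 / \<alpha> - 1 / \<beta> - lam) / (\<bar>lam\<bar> * \<bar>lam + 1 / \<alpha> + 1 / \<beta>\<bar>))"
proof -
  let ?a = "1 + \<alpha> * lam" and ?b = "1 + \<beta> * lam"
  have a: "?a < 0" and b: "?b < 0"
    using lam pos by (simp_all add: field_simps)
  have "lam < 0" using lam(1) pos by (smt (verit) divide_neg_pos)
  have "?a * ?b > 0" using a b by (rule mult_neg_neg)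
  then have eq: "1 - \<bar>?a * ?b\<bar> = - (\<alpha> * \<beta> * (lam * (lam + 1 / \<alpha> + 1 / \<beta>)))"
    using pos by (simp add: field_simps)
  have ab: "\<bar>?a * ?b\<bar> \<noteq> 1"
    using eq ne pos \<open>lam < 0\<close> by auto
  have "\<bar>?b\<bar> * \<alpha> + \<beta> = \<alpha> * \<beta> * (1 / \<alpha> - 1 / \<beta> - lam)"
    "\<bar>?a\<bar> * \<beta> + \<alpha> = \<alpha> * \<beta> * (1 / \<beta> - 1 / \<alpha> - lam)"
    unfolding abs_of_neg[OF a] abs_of_neg[OF b] using pos by (simp_all add: field_simps)
  then have num: "max (\<bar>?b\<bar> * \<alpha> + \<beta>) (\<bar>?a\<bar> * \<beta> + \<alpha>) =
      \<alpha> * \<beta> * max (1 / \<beta> - 1 / \<alpha> - lam) (1 / \<alpha> - 1 / \<beta> - lam)"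
    using pos by (simp only: max_mult_distrib_left) (simp add: max.commute)
  have den: "\<bar>1 - \<bar>?a * ?b\<bar>\<bar> = \<alpha> * \<beta> * (\<bar>lam\<bar> * \<bar>lam + 1 / \<alpha> + 1 / \<beta>\<bar>)"
    unfolding eq using pos by (simp only: abs_minus_cancel abs_mult abs_of_pos)
  have "\<alpha> * \<beta> \<noteq> 0" using pos by simp
  then show ?thesis
    using HUS_constant_time_scale[OF pos ab] unfolding num den by simp
qed

text \<open>Both numerators equal \<open>S\<close>, and \<open>S\<close> also divides the
  denominator, since \<open>1 - ?a * ?b = - (lam * S)\<close>. Cancelling leaves
  \<open>1 / \<bar>lam\<bar>\<close>, which matches the lower bound.\<close>

lemma min_HUS_constant_both_positive:
  fixes \<alpha> \<beta> lam :: real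
  assumes pos: "\<alpha> > 0" "\<beta> > 0" and lam: "- 1 / \<alpha> < lam" "- 1 / \<beta> < lam" "lam \<noteq> 0"
  shows "min_HUS_constant (time_scale \<alpha> \<beta>) lam (1 / \<bar>lam\<bar>)"
proof -
  let ?a = "1 + \<alpha> * lam" and ?b = "1 + \<beta> * lam"
  have a: "?a > 0" and b: "?b > 0"
    using lam pos by (simp_all add: field_simps)
  define S where "S = \<alpha> + \<beta> + \<alpha> * \<beta> * lam"
  have "S = ?b * \<alpha> + \<beta>" by (simp add: S_def algebra_simps)
  then have S: "S > 0" using b pos by (simp add: add_pos_pos)
  have "?a * ?b > 0" using a b by (rule mult_pos_pos)
  then have eq: "1 - \<bar>?a * ?b\<bar> = - (lam * S)"
    by (simp add: S_def algebra_simps)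
  have ne: "\<bar>?a * ?b\<bar> \<noteq> 1"
    using eq S lam by auto
  have "max (\<bar>?b\<bar> * \<alpha> + \<beta>) (\<bar>?a\<bar> * \<beta> + \<alpha>) = S"
    using a b by (simp add: S_def algebra_simps)
  then have "HUS_constant (time_scale \<alpha> \<beta>) lam (1 / \<bar>lam\<bar>)"
    using HUS_constant_time_scale[OF pos ne] S eq by (simp add: abs_mult)
  with HUS_constant_ge_inverse[OF pos lam(3) ne] show ?thesis
    by (simp add: min_HUS_constant_def)
qed

section \<open>The roots \<open>lam_plus\<close> and \<open>lam_minus\<close> and their
  location\<close>

text \<open>The two numbers are the roots of
  \<open>(1 + \<alpha> * lam) * (1 + \<beta> * lam) = - 1\<close>, whose discriminant
  \<open>(\<alpha> + \<beta>)\<^sup>2 - 8 * \<alpha> * \<beta>\<close> is the expression under the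
  root. The sign condition ensures that the square root squares back to it.\<close>

lemma lam_plus_minus_factorization:
  fixes \<alpha> \<beta> lam :: real
  assumes pos: "\<alpha> > 0" "\<beta> > 0" and disc: "\<alpha>\<^sup>2 + \<beta>\<^sup>2 - 6 * \<alpha> * \<beta> \<ge> 0"
  shows "(lam - lam_plus \<alpha> \<beta>) * (lam - lam_minus \<alpha> \<beta>) =
    (2 + \<alpha> * lam + \<beta> * lam + \<alpha> * \<beta> * lam\<^sup>2) / (\<alpha> * \<beta>)"
proof -
  define s where "s = sqrt (\<alpha>\<^sup>2 + \<beta>\<^sup>2 - 6 * \<alpha> * \<beta>)"
  have s: "s\<^sup>2 = \<alpha>\<^sup>2 + \<beta>\<^sup>2 - 6 * \<alpha> * \<beta>" using disc by (simp add: s_def)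
  have "(lam - lam_plus \<alpha> \<beta>) * (lam - lam_minus \<alpha> \<beta>) =
      ((2 * \<alpha> * \<beta> * lam + \<alpha> + \<beta>)\<^sup>2 - s\<^sup>2) / (4 * \<alpha>\<^sup>2 * \<beta>\<^sup>2)"
    using pos unfolding lam_plus_def lam_minus_def s_def[symmetric]
    by (simp add: field_simps power2_eq_square)
  also have "\<dots> = (2 + \<alpha> * lam + \<beta> * lam + \<alpha> * \<beta> * lam\<^sup>2) / (\<alpha> * \<beta>)"
    using pos unfolding s by (simp add: field_simps power2_eq_square)
  finally show ?thesis .
qed

text \<open>Translates the thresholds on \<alpha> in terms of \<beta> into the sign of the
  discriminant.\<close>

lemma discriminant_factorization:
  fixes \<alpha> \<beta> :: real
  shows "\<alpha>\<^sup>2 + \<beta>\<^sup>2 - 6 * \<alpha> * \<beta> = (\<alpha> - (3 + 2 * sqrt 2) * \<beta>) * (\<alpha> - (3 - 2 * sqrt 2) * \<beta>)"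
proof -
  have "(\<alpha> - (3 + 2 * sqrt 2) * \<beta>) * (\<alpha> - (3 - 2 * sqrt 2) * \<beta>) =
    \<alpha>\<^sup>2 - 6 * \<alpha> * \<beta> + (9 - 4 * (sqrt 2)\<^sup>2) * \<beta>\<^sup>2"
    by (simp only: power2_eq_square) (simp add: algebra_simps)
  then show ?thesis by simp
qed

text \<open>The midpoint of the two roots is \<open>- (1 / \<alpha> + 1 / \<beta>) / 2\<close>, which separates \<open>- 1 / \<alpha>\<close> from \<open>- 1 / \<beta>\<close>.\<close>
lemma lam_minus_le_lam_plus_bounds:
  fixes \<alpha> \<beta> :: real
  assumes pos: "\<alpha> > 0" "\<beta> > 0" and disc: "\<alpha>\<^sup>2 + \<beta>\<^sup>2 - 6 * \<alpha> * \<beta> \<ge> 0"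
  shows "lam_minus \<alpha> \<beta> \<le> - (1 / \<alpha> + 1 / \<beta>) / 2" "- (1 / \<alpha> + 1 / \<beta>) / 2 \<le> lam_plus \<alpha> \<beta>"
proof -
  have "sqrt (\<alpha>\<^sup>2 + \<beta>\<^sup>2 - 6 * \<alpha> * \<beta>) \<ge> 0" using disc by simp
  moreover have "- (1 / \<alpha> + 1 / \<beta>) / 2 = (- \<alpha> - \<beta>) / (2 * \<alpha> * \<beta>)"
    using pos by (simp add: field_simps)
  ultimately show "lam_minus \<alpha> \<beta> \<le> - (1 / \<alpha> + 1 / \<beta>) / 2" "- (1 / \<alpha> + 1 / \<beta>) / 2 \<le> lam_plus \<alpha> \<beta>"
    using pos by (simp_all only: lam_minus_def lam_plus_def) (auto intro!: divide_right_mono)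
qed

text \<open>The discriminant is
  \<open>(\<alpha> - \<beta>)\<^sup>2 - 4 * \<alpha> * \<beta>\<close>, so its root is less than
  \<open>\<bar>\<alpha> - \<beta>\<bar>\<close>. Hence a \<open>lam\<close> between the two roots
  falls where the factors have opposite signs.\<close>

lemma lam_plus_minus_strict_bounds:
  fixes \<alpha> \<beta> :: real
  assumes pos: "\<alpha> > 0" "\<beta> > 0" and disc: "\<alpha>\<^sup>2 + \<beta>\<^sup>2 - 6 * \<alpha> * \<beta> \<ge> 0"
  shows "min (- 1 / \<alpha>) (- 1 / \<beta>) < lam_minus \<alpha> \<beta>" "lam_plus \<alpha> \<beta> < max (- 1 / \<alpha>) (- 1 / \<beta>)"
proof -
  define s where "s = sqrt (\<alpha>\<^sup>2 + \<beta>\<^sup>2 - 6 * \<alpha> * \<beta>)"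
  have "\<alpha> * \<beta> > 0" using pos by simp
  then have "s < sqrt ((\<alpha> - \<beta>)\<^sup>2)"
    unfolding s_def by (intro real_sqrt_less_mono) (simp add: power2_diff)
  then have "s < \<bar>\<alpha> - \<beta>\<bar>" by simp
  have eqs: "- 1 / \<alpha> = (- \<beta> - \<beta>) / (2 * \<alpha> * \<beta>)" "- 1 / \<beta> = (- \<alpha> - \<alpha>) / (2 * \<alpha> * \<beta>)"
    using pos by (simp_all add: field_simps)
  have div: "x < y \<Longrightarrow> x / (2 * \<alpha> * \<beta>) < y / (2 * \<alpha> * \<beta>)" for x y
    using pos by (intro divide_strict_right_mono) auto
  consider "s < \<alpha> - \<beta>" | "s < \<beta> - \<alpha>"
    using \<open>s < \<bar>\<alpha> - \<beta>\<bar>\<close> by linarith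
  then have "- 1 / \<beta> < lam_minus \<alpha> \<beta> \<and> lam_plus \<alpha> \<beta> < - 1 / \<alpha> \<or>
    - 1 / \<alpha> < lam_minus \<alpha> \<beta> \<and> lam_plus \<alpha> \<beta> < - 1 / \<beta>"
  proof cases
    case 1
    then show ?thesis
      unfolding lam_minus_def lam_plus_def s_def[symmetric] eqs
      by (intro disjI1 conjI div) simp_all
  next
    case 2
    then show ?thesis
      unfolding lam_minus_def lam_plus_def s_def[symmetric] eqs
      by (intro disjI2 conjI div) simp_all
  qed
  then show "min (- 1 / \<alpha>) (- 1 / \<beta>) < lam_minus \<alpha> \<beta>" "lam_plus \<alpha> \<beta> < max (- 1 / \<alpha>) (- 1 / \<beta>)"
    unfolding min_less_iff_disj less_max_iff_disj by blast+
qed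

section \<open>Assembly of the cases\<close>

theorem theorem1p3:
  fixes \<alpha> \<beta> lam :: real
  assumes "\<alpha> > 0" and "\<beta> > 0" and "\<alpha> \<noteq> \<beta>"
  shows
    \<comment> \<open>A\<close>
    "(\<alpha> \<ge> (3 + 2 * sqrt 2) * \<beta> \<and>
        (- 1 / \<beta> < lam \<and> lam < lam_minus \<alpha> \<beta> \<or> lam_plus \<alpha> \<beta> < lam \<and> lam < - 1 / \<alpha>) \<longrightarrow>
        HUS_constant (time_scale \<alpha> \<beta>) lam
          (\<bar>lam + 1 / \<alpha> - 1 / \<beta>\<bar> / ((lam - lam_plus \<alpha> \<beta>) * (lam - lam_minus \<alpha> \<beta>)))) \<and>
     (\<alpha> > (3 + 2 * sqrt 2) * \<beta> \<and> lam_minus \<alpha> \<beta> < lam \<and> lam < lam_plus \<alpha> \<beta> \<longrightarrow>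
        HUS_constant (time_scale \<alpha> \<beta>) lam
          \<bar>(lam + 1 / \<alpha> - 1 / \<beta>) / ((lam - lam_plus \<alpha> \<beta>) * (lam - lam_minus \<alpha> \<beta>))\<bar>) \<and>
     (\<beta> < \<alpha> \<and> \<alpha> < (3 + 2 * sqrt 2) * \<beta> \<and> - 1 / \<beta> < lam \<and> lam < - 1 / \<alpha> \<longrightarrow>
        HUS_constant (time_scale \<alpha> \<beta>) lam
          \<bar>(lam + 1 / \<alpha> - 1 / \<beta>) / ((2 + \<alpha> * lam + \<beta> * lam + \<alpha> * \<beta> * lam\<^sup>2) / (\<alpha> * \<beta>))\<bar>) \<and>
     (0 < \<alpha> \<and> \<alpha> \<le> (3 - 2 * sqrt 2) * \<beta> \<and>
        (- 1 / \<alpha> < lam \<and> lam < lam_minus \<alpha> \<beta> \<or> lam_plus \<alpha> \<beta> < lam \<and> lam < - 1 / \<beta>) \<longrightarrow>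
        HUS_constant (time_scale \<alpha> \<beta>) lam
          ((1 / \<alpha> - 1 / \<beta> - lam) / ((lam - lam_plus \<alpha> \<beta>) * (lam - lam_minus \<alpha> \<beta>)))) \<and>
     (0 < \<alpha> \<and> \<alpha> < (3 - 2 * sqrt 2) * \<beta> \<and> lam_minus \<alpha> \<beta> < lam \<and> lam < lam_plus \<alpha> \<beta> \<longrightarrow>
        HUS_constant (time_scale \<alpha> \<beta>) lam
          ((1 / \<alpha> - 1 / \<beta> - lam) / \<bar>(lam - lam_plus \<alpha> \<beta>) * (lam - lam_minus \<alpha> \<beta>)\<bar>)) \<and>
     ((3 - 2 * sqrt 2) * \<beta> < \<alpha> \<and> \<alpha> < \<beta> \<and> - 1 / \<alpha> < lam \<and> lam < - 1 / \<beta> \<longrightarrow>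
        HUS_constant (time_scale \<alpha> \<beta>) lam
          \<bar>(1 / \<alpha> - 1 / \<beta> - lam) / ((2 + \<alpha> * lam + \<beta> * lam + \<alpha> * \<beta> * lam\<^sup>2) / (\<alpha> * \<beta>))\<bar>) \<and>
     (- 1 / \<alpha> - 1 / \<beta> < lam \<and> lam < min (- 1 / \<alpha>) (- 1 / \<beta>) \<longrightarrow>
        HUS_constant (time_scale \<alpha> \<beta>) lam
          (max (1 / \<beta> - 1 / \<alpha> - lam) (1 / \<alpha> - 1 / \<beta> - lam) / (\<bar>lam\<bar> * (lam + 1 / \<alpha> + 1 / \<beta>)))) \<and>
     (lam < - 1 / \<alpha> - 1 / \<beta> \<longrightarrow>
        HUS_constant (time_scale \<alpha> \<beta>) lam
          (max (1 / \<beta> - 1 / \<alpha> - lam) (1 / \<alpha> - 1 / \<beta> - lam) / (\<bar>lam\<bar> * \<bar>lam + 1 / \<alpha> + 1 / \<beta>\<bar>))) \<and>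
     (max (- 1 / \<alpha>) (- 1 / \<beta>) < lam \<and> lam < 0 \<or> lam > 0 \<longrightarrow>
        min_HUS_constant (time_scale \<alpha> \<beta>) lam (1 / \<bar>lam\<bar>)) \<and>
     (lam = 0 \<or>
        \<alpha>\<^sup>2 + \<beta>\<^sup>2 - 6 * \<alpha> * \<beta> \<ge> 0 \<and> (lam = lam_plus \<alpha> \<beta> \<or> lam = lam_minus \<alpha> \<beta>) \<or>
        lam = - 1 / \<alpha> - 1 / \<beta> \<longrightarrow>
        \<not> has_HUS (time_scale \<alpha> \<beta>) lam) \<and>
     (lam = - 1 / \<alpha> \<or> lam = - 1 / \<beta> \<longrightarrow>
        \<not> regressive (time_scale \<alpha> \<beta>) lam)"
proof -
  let ?T = "time_scale \<alpha> \<beta>"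
  let ?F = "(2 + \<alpha> * lam + \<beta> * lam + \<alpha> * \<beta> * lam\<^sup>2) / (\<alpha> * \<beta>)"
  let ?disc = "\<alpha>\<^sup>2 + \<beta>\<^sup>2 - 6 * \<alpha> * \<beta>"
  let ?G = "(lam - lam_plus \<alpha> \<beta>) * (lam - lam_minus \<alpha> \<beta>)"
  note pos = \<open>\<alpha> > 0\<close> \<open>\<beta> > 0\<close>
  note opp = HUS_constant_opposite_signs[OF pos]
  note G = lam_plus_minus_factorization[OF pos, of lam]
  note mid = lam_minus_le_lam_plus_bounds[OF pos] and bounds = lam_plus_minus_strict_bounds[OF pos]
  \<comment> \<open>Completing the square: with a negative discriminant \<open>?F\<close> has no
    real root, so resonance cannot occur in the intermediate regimes \<open>C\<close> and
    \<open>F\<close>.\<close>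
  have F_pos: "?F > 0" if "?disc < 0"
  proof -
    have "4 * \<alpha> * \<beta> * (2 + \<alpha> * lam + \<beta> * lam + \<alpha> * \<beta> * lam\<^sup>2) = (2 * \<alpha> * \<beta> * lam + \<alpha> + \<beta>)\<^sup>2 - ?disc"
      by (simp add: power2_eq_square algebra_simps)
    also have "\<dots> > 0" using that by (smt (verit) zero_le_power2)
    finally have "4 * \<alpha> * \<beta> * (2 + \<alpha> * lam + \<beta> * lam + \<alpha> * \<beta> * lam\<^sup>2) > 0" .
    then have "2 + \<alpha> * lam + \<beta> * lam + \<alpha> * \<beta> * lam\<^sup>2 > 0"
      using pos by (simp add: zero_less_mult_iff mult_less_0_iff)
    then show ?thesis using pos by simp
  qed
  have one_between_coeffs: "(3 - 2 * sqrt 2) * \<beta> < \<beta>" "\<beta> < (3 + 2 * sqrt 2) * \<beta>"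
  proof -
    have "3 - 2 * sqrt 2 < (1::real)" "1 < 3 + 2 * sqrt 2"
      by (simp_all add: add_pos_pos)
    then show "(3 - 2 * sqrt 2) * \<beta> < \<beta>" "\<beta> < (3 + 2 * sqrt 2) * \<beta>"
      using pos mult_strict_right_mono[of _ _ \<beta>] by fastforce+
  qed
  have big: "\<alpha> > \<beta>" "?disc \<ge> 0" "- 1 / \<beta> < - 1 / \<alpha>" if "\<alpha> \<ge> (3 + 2 * sqrt 2) * \<beta>"
  proof -
    show "\<alpha> > \<beta>" "?disc \<ge> 0"
      unfolding discriminant_factorization using that one_between_coeffs by simp_all
    then show "- 1 / \<beta> < - 1 / \<alpha>" using pos by (simp add: field_simps)
  qed
  have small: "\<alpha> < \<beta>" "?disc \<ge> 0" "- 1 / \<alpha> < - 1 / \<beta>" if "\<alpha> \<le> (3 - 2 * sqrt 2) * \<beta>"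
  proof -
    show "\<alpha> < \<beta>" "?disc \<ge> 0"
      unfolding discriminant_factorization using that one_between_coeffs by (simp_all add: mult_nonpos_nonpos)
    then show "- 1 / \<alpha> < - 1 / \<beta>" using pos by (simp add: field_simps)
  qed
  have A: "HUS_constant ?T lam (\<bar>lam + 1 / \<alpha> - 1 / \<beta>\<bar> / ?G)"
    if h: "\<alpha> \<ge> (3 + 2 * sqrt 2) * \<beta>"
      "- 1 / \<beta> < lam \<and> lam < lam_minus \<alpha> \<beta> \<or> lam_plus \<alpha> \<beta> < lam \<and> lam < - 1 / \<alpha>"
  proof -
    note b = big[OF h(1)]
    \<comment> \<open>Only one end of the interval for \<open>lam\<close> is given in each
      alternative. The other follows because the midpoint of the roots lies strictly between
      \<open>- 1 / \<beta>\<close> and \<open>- 1 / \<alpha>\<close>; outside the roots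
      \<open>?G\<close> is positive.\<close>
    have G_pos: "?G > 0" and lam: "- 1 / \<beta> < lam" "lam < - 1 / \<alpha>"
      using h(2) mid[OF b(2)] b(3) by (auto simp: zero_less_mult_iff)
    show ?thesis
      using opp(1)[of lam, folded G[OF b(2)], OF less_imp_neq[OF G_pos, symmetric] lam]
      by (simp only: abs_of_pos[OF G_pos])
  qed
  have B: "HUS_constant ?T lam \<bar>(lam + 1 / \<alpha> - 1 / \<beta>) / ?G\<bar>"
    if h: "\<alpha> > (3 + 2 * sqrt 2) * \<beta>" "lam_minus \<alpha> \<beta> < lam" "lam < lam_plus \<alpha> \<beta>"
  proof -
    note b = big[OF less_imp_le[OF h(1)]]
    have G_nz: "?G \<noteq> 0" and lam: "- 1 / \<beta> < lam" "lam < - 1 / \<alpha>"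
      using h bounds[OF b(2)] b(3) by auto
    show ?thesis
      using opp(1)[of lam, folded G[OF b(2)], OF G_nz lam] by (simp only: abs_divide)
  qed
  have C: "HUS_constant ?T lam \<bar>(lam + 1 / \<alpha> - 1 / \<beta>) / ?F\<bar>"
    if h: "\<beta> < \<alpha>" "\<alpha> < (3 + 2 * sqrt 2) * \<beta>" "- 1 / \<beta> < lam" "lam < - 1 / \<alpha>"
  proof -
    have "?disc < 0"
      unfolding discriminant_factorization using h one_between_coeffs by (simp add: mult_neg_pos)
    then show ?thesis
      using opp(1)[OF less_imp_neq[OF F_pos, symmetric] h(3,4)] by (simp only: abs_divide)
  qed
  have D: "HUS_constant ?T lam ((1 / \<alpha> - 1 / \<beta> - lam) / ?G)"
    if h: "\<alpha> \<le> (3 - 2 * sqrt 2) * \<beta>"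
      "- 1 / \<alpha> < lam \<and> lam < lam_minus \<alpha> \<beta> \<or> lam_plus \<alpha> \<beta> < lam \<and> lam < - 1 / \<beta>"
  proof -
    note b = small[OF h(1)]
    have G_pos: "?G > 0" and lam: "- 1 / \<alpha> < lam" "lam < - 1 / \<beta>"
      using h(2) mid[OF b(2)] b(3) by (auto simp: zero_less_mult_iff)
    show ?thesis
      using opp(2)[of lam, folded G[OF b(2)], OF less_imp_neq[OF G_pos, symmetric] lam]
      by (simp only: abs_of_pos[OF G_pos])
  qed
  have E: "HUS_constant ?T lam ((1 / \<alpha> - 1 / \<beta> - lam) / \<bar>?G\<bar>)"
    if h: "\<alpha> < (3 - 2 * sqrt 2) * \<beta>" "lam_minus \<alpha> \<beta> < lam" "lam < lam_plus \<alpha> \<beta>"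
  proof -
    note b = small[OF less_imp_le[OF h(1)]]
    have G_nz: "?G \<noteq> 0" and lam: "- 1 / \<alpha> < lam" "lam < - 1 / \<beta>"
      using h bounds[OF b(2)] b(3) by auto
    show ?thesis
      using opp(2)[of lam, folded G[OF b(2)], OF G_nz lam] by (simp only: abs_divide)
  qed
  have F: "HUS_constant ?T lam \<bar>(1 / \<alpha> - 1 / \<beta> - lam) / ?F\<bar>"
    if h: "(3 - 2 * sqrt 2) * \<beta> < \<alpha>" "\<alpha> < \<beta>" "- 1 / \<alpha> < lam" "lam < - 1 / \<beta>"
  proof -
    have "?disc < 0"
      unfolding discriminant_factorization using h one_between_coeffs by (simp add: mult_neg_pos)
    have "1 / \<alpha> > 0" using pos by simp
    then have "\<bar>1 / \<alpha> - 1 / \<beta> - lam\<bar> = 1 / \<alpha> - 1 / \<beta> - lam"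
      using h(4) by (intro abs_of_pos) linarith
    then show ?thesis
      using opp(2)[OF less_imp_neq[OF F_pos[OF \<open>?disc < 0\<close>], symmetric] h(3,4)]
      by (simp only: abs_divide)
  qed
  have neg: "1 / \<alpha> > 0" "1 / \<beta> > 0" using pos by simp_all
  have J: "\<not> has_HUS ?T lam"
    if h: "lam = 0 \<or> ?disc \<ge> 0 \<and> (lam = lam_plus \<alpha> \<beta> \<or> lam = lam_minus \<alpha> \<beta>) \<or> lam = - 1 / \<alpha> - 1 / \<beta>"
  proof (rule not_has_HUS_of_resonance[OF pos])
    \<comment> \<open>The product of the two factors is 1 for \<open>lam = 0\<close>, -1 at the two
      roots, and 1 again in the last case, where the factors are
      \<open>- (\<alpha> / \<beta>)\<close> and \<open>- (\<beta> / \<alpha>)\<close>.\<close>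
    consider "lam = 0" | "?disc \<ge> 0" "lam = lam_plus \<alpha> \<beta> \<or> lam = lam_minus \<alpha> \<beta>" | "lam = - 1 / \<alpha> - 1 / \<beta>"
      using h by blast
    then show "\<bar>(1 + \<alpha> * lam) * (1 + \<beta> * lam)\<bar> = 1"
    proof cases
      case 2
      then have "?G = 0" by auto
      then have "?F = 0" using G[OF 2(1)] by simp
      then have "2 + \<alpha> * lam + \<beta> * lam + \<alpha> * \<beta> * lam\<^sup>2 = 0" using pos by simp
      then have "(1 + \<alpha> * lam) * (1 + \<beta> * lam) = - 1" by (simp add: algebra_simps power2_eq_square)
      then show ?thesis by simp
    next
      case 3
      then have "1 + \<alpha> * lam = - (\<alpha> / \<beta>)" "1 + \<beta> * lam = - (\<beta> / \<alpha>)"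
        using pos by (simp_all add: field_simps)
      then show ?thesis using pos by simp
    qed simp
  qed
  have K: "\<not> regressive ?T lam" if "lam = - 1 / \<alpha> \<or> lam = - 1 / \<beta>"
  proof -
    \<comment> \<open>The first two points already show both values of the graininess, \<alpha> at
      index 0 and \<beta> at index 1.\<close>
    have "1 + lam * graininess ?T (point \<alpha> \<beta> 0) = 0 \<or> 1 + lam * graininess ?T (point \<alpha> \<beta> 1) = 0"
      using that pos unfolding graininess_point[OF pos] by (auto simp: step_def)
    then show ?thesis
      unfolding regressive_def by (metis time_scale_eq_range_point rangeI)
  qed
  have GH: "HUS_constant ?T lam
      (max (1 / \<beta> - 1 / \<alpha> - lam) (1 / \<alpha> - 1 / \<beta> - lam) / (\<bar>lam\<bar> * \<bar>lam + 1 / \<alpha> + 1 / \<beta>\<bar>))"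
    if "lam < min (- 1 / \<alpha>) (- 1 / \<beta>)" "lam \<noteq> - 1 / \<alpha> - 1 / \<beta>"
    using that HUS_constant_both_negative[OF pos] by simp
  have GG: "HUS_constant ?T lam
      (max (1 / \<beta> - 1 / \<alpha> - lam) (1 / \<alpha> - 1 / \<beta> - lam) / (\<bar>lam\<bar> * (lam + 1 / \<alpha> + 1 / \<beta>)))"
    if h: "- 1 / \<alpha> - 1 / \<beta> < lam" "lam < min (- 1 / \<alpha>) (- 1 / \<beta>)"
  proof -
    have "\<bar>lam + 1 / \<alpha> + 1 / \<beta>\<bar> = lam + 1 / \<alpha> + 1 / \<beta>" using h(1) by simp
    then show ?thesis using GH h by simp
  qed
  have H: "HUS_constant ?T lam
      (max (1 / \<beta> - 1 / \<alpha> - lam) (1 / \<alpha> - 1 / \<beta> - lam) / (\<bar>lam\<bar> * \<bar>lam + 1 / \<alpha> + 1 / \<beta>\<bar>))"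
    if "lam < - 1 / \<alpha> - 1 / \<beta>"
  proof -
    have "lam < - 1 / \<alpha>" "lam < - 1 / \<beta>" using that neg by linarith+
    then show ?thesis using GH that by simp
  qed
  have I: "min_HUS_constant ?T lam (1 / \<bar>lam\<bar>)"
    if "max (- 1 / \<alpha>) (- 1 / \<beta>) < lam \<and> lam < 0 \<or> lam > 0"
  proof -
    have "- 1 / \<alpha> < lam" "- 1 / \<beta> < lam" "lam \<noteq> 0" using that neg by linarith+
    then show ?thesis by (rule min_HUS_constant_both_positive[OF pos])
  qed
  show ?thesis
    by (intro conjI impI; (elim conjE)?; rule A B C D E F GG H I J K; assumption)
qed

end
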